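(* Let $f$ and $g$ be two holomorphic functions in a domain $\Omega\subset\mathbb C$ and let $M>0$ be a constant. For integers $i,j\ge 1$ define the holomorphic function on $\Omega$ \[\tilde h_{i,j}:=\frac{1}{i!\,j!}\left(f^{(i)}g^{(j)}-f^{(j)}g^{(i)}\right).\] Suppose that the function \[\tilde h_{1,2}\left(\tilde h_{2,4}^2-\tilde h_{3,4}(2\tilde h_{2,3}+\tilde h_{1,4})\right)+\tilde h_{1,3}\left(\tilde h_{1,3}\tilde h_{3,4}-\tilde h_{2,3}\tilde h_{2,4}\right)+\tilde h_{2,3}^3\] is not identically zero on $\Omega$. Then there exist $A,B\in M_{10}(\mathbb C)$ with spectrum contained in $\Omega$ such that $A$ and $B$ have identical pseudospectra and \[\frac{\|f(A)\|}{\|f(B)\|}>M\qquad\text{and}\qquad\frac{\|g(A)\|}{\|g(B)\|}>M.\]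
   Context: For $N\ge 1$, $M_N(\mathbb C)$ is the algebra of complex $N\times N$ matrices, and $\|\cdot\|$ is the operator norm on $M_N(\mathbb C)$ associated with the Euclidean norm on $\mathbb C^N$. A domain is a nonempty connected open set. Two matrices $A,B\in M_N(\mathbb C)$ have identical pseudospectra if $\|(zI-A)^{-1}\|=\|(zI-B)^{-1}\|$ for all $z\in\mathbb C$, with the convention that $\|(zI-A)^{-1}\|=\infty$ if $z$ is an eigenvalue of $A$ (and likewise for $B$). For $f$ holomorphic in $\Omega$ and a matrix $A$ with spectrum in $\Omega$, $f(A)$ is defined by the holomorphic functional calculus; $f^{(i)}$ denotes the $i$-th derivative of $f$. *)

theory Defs
  imports "HOL-Complex_Analysis.Complex_Analysis"
begin

no_notation fps_nth (infixl "$" 75)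

definition mat_spectrum :: "complex^'n^'n \<Rightarrow> complex set" where
  "mat_spectrum A = {z. \<exists>v. v \<noteq> 0 \<and> A *v v = z *s v}"

text \<open>The norm on \<^typ>\<open>complex^'n\<close> is the Euclidean one, so this is the induced operator norm;
  the type class norm on \<^typ>\<open>complex^'n^'n\<close> is the Frobenius norm instead.\<close>

definition opnorm :: "complex^'n^'n \<Rightarrow> real" where
  "opnorm A = onorm (\<lambda>v. A *v v)"

text \<open>\<^term>\<open>mat z\<close> is the scalar matrix \<open>z I\<close>.\<close>

definition resolvent :: "complex^'n^'n \<Rightarrow> complex \<Rightarrow> complex^'n^'n" where
  "resolvent A z = matrix_inv (mat z - A)"

definition resolvent_norm :: "complex^'n^'n \<Rightarrow> complex \<Rightarrow> ereal" where
  "resolvent_norm A z = (if z \<in> mat_spectrum A then \<infinity> else ereal (opnorm (resolvent A z)))"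

definition identical_pseudospectra :: "complex^'n^'n \<Rightarrow> complex^'n^'n \<Rightarrow> bool" where
  "identical_pseudospectra A B \<longleftrightarrow> (\<forall>z. resolvent_norm A z = resolvent_norm B z)"

definition surrounds :: "(real \<Rightarrow> complex) \<Rightarrow> complex set \<Rightarrow> complex set \<Rightarrow> bool" where
  "surrounds \<gamma> K \<Omega> \<longleftrightarrow>
     valid_path \<gamma> \<and> pathfinish \<gamma> = pathstart \<gamma> \<and> path_image \<gamma> \<subseteq> \<Omega> - K \<and>
     (\<forall>z\<in>K. winding_number \<gamma> z = 1) \<and> (\<forall>z. z \<notin> \<Omega> \<longrightarrow> winding_number \<gamma> z = 0)"

text \<open>The entrywise Cauchy integral \<open>f(A) = 1/(2\<pi>i) \<integral>\<^sub>\<gamma> f(z) (zI - A)\<^sup>-\<^sup>1 dz\<close>. In a domain \<open>\<Omega>\<close> containing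
  the spectrum a single closed path \<open>\<gamma>\<close> suffices (\<open>surrounds_exists\<close>), and the
  value does not depend on its choice (\<open>hol_fun_calc_eq\<close>).\<close>

definition cauchy_fun_calc ::
    "(real \<Rightarrow> complex) \<Rightarrow> (complex \<Rightarrow> complex) \<Rightarrow> complex^'n^'n \<Rightarrow> complex^'n^'n" where
  "cauchy_fun_calc \<gamma> f A =
     (\<chi> i j. 1 / (2 * pi * \<i>) * contour_integral \<gamma> (\<lambda>z. f z * resolvent A z $ i $ j))"

definition hol_fun_calc ::
    "complex set \<Rightarrow> (complex \<Rightarrow> complex) \<Rightarrow> complex^'n^'n \<Rightarrow> complex^'n^'n" where
  "hol_fun_calc \<Omega> f A = cauchy_fun_calc (SOME \<gamma>. surrounds \<gamma> (mat_spectrum A) \<Omega>) f A"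

lemma surrounds_exists:
  assumes \<Omega>: "open \<Omega>" "connected \<Omega>" "\<Omega> \<noteq> {}" and K: "finite K" "K \<subseteq> \<Omega>"
  shows "\<exists>\<gamma>. surrounds \<gamma> K \<Omega>"
proof -
  have opn: "open (\<Omega> - K)"
    using \<Omega> K by (simp add: finite_imp_closed open_Diff)
  have con: "connected (\<Omega> - K)"
    using \<Omega> K by (intro connected_open_delete_finite) auto
  have "infinite \<Omega>"
    using \<Omega> finite_imp_not_open by blast
  then obtain p where p: "p \<in> \<Omega> - K"
    using K by (metis finite_Diff2 finite.emptyI ex_in_conv)
  have "\<exists>\<gamma>. valid_path \<gamma> \<and> pathstart \<gamma> = p \<and> pathfinish \<gamma> = p \<and> path_image \<gamma> \<subseteq> \<Omega> - K \<and>
       (\<forall>z. z \<in> K \<longrightarrow> winding_number \<gamma> z = (if z \<in> L then 1 else 0)) \<and>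
       (\<forall>z. z \<notin> \<Omega> \<longrightarrow> winding_number \<gamma> z = 0)" if "L \<subseteq> K" for L
    using finite_subset[OF that K(1)] that
  proof (induction L rule: finite_induct)
    case empty
    show ?case
      using p by (intro exI[of _ "linepath p p"])
        (auto simp del: linepath_trivial intro!: winding_number_trivial)
  next
    case (insert l L)
    then obtain \<gamma> where \<gamma>: "valid_path \<gamma>" "pathstart \<gamma> = p" "pathfinish \<gamma> = p"
        "path_image \<gamma> \<subseteq> \<Omega> - K"
        "\<And>z. z \<in> K \<Longrightarrow> winding_number \<gamma> z = (if z \<in> L then 1 else 0)"
        "\<And>z. z \<notin> \<Omega> \<Longrightarrow> winding_number \<gamma> z = 0"
      by auto
    have "open (\<Omega> - (K - {l}))" "l \<in> \<Omega> - (K - {l})"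
      using \<Omega> K insert.prems by (auto simp: finite_imp_closed open_Diff)
    then obtain r where r: "r > 0" "cball l r \<subseteq> \<Omega> - (K - {l})"
      using open_contains_cball by meson
    define c where "c = circlepath l r"
    have c: "valid_path c" "path_image c \<subseteq> \<Omega> - K" "pathfinish c = pathstart c"
      using r by (auto simp: c_def)
    have cw1: "winding_number c l = 1"
      using r by (simp add: c_def winding_number_circlepath_centre)
    have cw0: "winding_number c z = 0" if "z \<notin> cball l r" for z
      using that r by (intro winding_number_zero_outside[of _ "cball l r"]) (auto simp: c_def)
    have "pathstart c \<in> \<Omega> - K"
      using c by auto
    then obtain g where g: "polynomial_function g" "path_image g \<subseteq> \<Omega> - K"
        "pathstart g = p" "pathfinish g = pathstart c"
      using connected_open_polynomial_connected[OF opn con p] by metis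
    have gv: "valid_path g"
      using g valid_path_polynomial_function by blast
    define \<delta> where "\<delta> = \<gamma> +++ (g +++ (c +++ reversepath g))"
    have \<delta>: "valid_path \<delta>" "pathstart \<delta> = p" "pathfinish \<delta> = p"
      using \<gamma> g gv c by (auto simp: \<delta>_def intro!: valid_path_join)
    have im: "path_image \<delta> \<subseteq> \<Omega> - K"
      using \<gamma> g c by (auto simp: \<delta>_def path_image_join)
    have w: "winding_number \<delta> z = winding_number \<gamma> z + winding_number c z"
      if "z \<notin> \<Omega> - K" for z
    proof -
      have "z \<notin> path_image \<gamma>" "z \<notin> path_image g" "z \<notin> path_image c"
        using that \<gamma> g c by auto
      then show ?thesis
        using \<gamma> g gv c
        by (simp add: \<delta>_def winding_number_join winding_number_reversepath valid_path_imp_path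
            path_image_join)
    qed
    have "winding_number \<delta> z = (if z \<in> insert l L then 1 else 0)" if "z \<in> K" for z
    proof (cases "z = l")
      case True
      then show ?thesis using w[of z] \<gamma>(5)[OF that] insert.hyps cw1 that by auto
    next
      case False
      then have "winding_number c z = 0" using cw0 r that by blast
      then show ?thesis using w[of z] \<gamma>(5)[OF that] that False by auto
    qed
    moreover have "winding_number \<delta> z = 0" if "z \<notin> \<Omega>" for z
      using w[of z] \<gamma>(6)[OF that] cw0[of z] r(2) that by (auto simp: subset_iff)
    ultimately show ?case
      using \<delta> im by blast
  qed
  from this[OF order.refl] show ?thesis
    unfolding surrounds_def by auto
qed

lemma mat_spectrum_iff_det:
  fixes A :: "complex^'n^'n"
  shows "z \<in> mat_spectrum A \<longleftrightarrow> det (mat z - A) = 0"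
proof -
  have "(mat z - A) *v v = z *s v - A *v v" for v :: "complex^'n"
  proof -
    have "mat z *v v = z *s v"
      by (simp add: vec_eq_iff matrix_vector_mult_def mat_def if_distrib if_distribR cong: if_cong)
    then show ?thesis
      by (simp add: matrix_vector_mult_diff_rdistrib)
  qed
  then have "z \<in> mat_spectrum A \<longleftrightarrow> (\<exists>v. v \<noteq> 0 \<and> (mat z - A) *v v = 0)"
    unfolding mat_spectrum_def by (simp add: eq_commute[of "_ *s _"])
  also have "\<dots> \<longleftrightarrow> \<not> invertible (mat z - A)"
    by (metis invertible_left_inverse matrix_left_invertible_ker)
  finally show ?thesis
    by (simp add: invertible_det_nz)
qed

lemma finite_mat_spectrum:
  fixes A :: "complex^'n^'n"
  shows "finite (mat_spectrum A)"
proof -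
  define P where "P = det (\<chi> i j. [:- A $ i $ j, if i = j then 1 else 0:] :: complex poly^'n^'n)"
  have P: "poly P z = det (mat z - A)" for z
    unfolding P_def det_def
    by (auto simp: poly_sum poly_prod mat_def of_int_poly intro!: sum.cong prod.cong)
  have bl: "bounded_linear (\<lambda>v. A *v v)"
    by simp
  define z where "z = complex_of_real (opnorm A + 1)"
  have "z \<notin> mat_spectrum A"
  proof
    assume "z \<in> mat_spectrum A"
    then obtain v where v: "v \<noteq> 0" "A *v v = z *s v"
      by (auto simp: mat_spectrum_def)
    have "norm (z *s v) = norm z * norm v"
      unfolding norm_vec_def by (simp add: L2_set_right_distrib norm_mult)
    moreover have "norm z = opnorm A + 1"
      using onorm_pos_le[OF bl] by (simp add: z_def opnorm_def)
    ultimately show False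
      using v onorm[OF bl, of v] by (simp add: opnorm_def)
  qed
  then have "P \<noteq> 0"
    using P[of z] by (auto simp: mat_spectrum_iff_det)
  then have "finite {z. poly P z = 0}"
    by (rule poly_roots_finite)
  then show ?thesis
    by (simp add: P mat_spectrum_iff_det[symmetric])
qed

lemma resolvent_mult:
  fixes A :: "complex^'n^'n"
  assumes "z \<notin> mat_spectrum A"
  shows "(mat z - A) ** resolvent A z = mat 1" "resolvent A z ** (mat z - A) = mat 1"
proof -
  have "invertible (mat z - A)"
    using assms by (simp add: invertible_det_nz mat_spectrum_iff_det)
  then have "(mat z - A) ** resolvent A z = mat 1 \<and> resolvent A z ** (mat z - A) = mat 1"
    unfolding resolvent_def matrix_inv_def invertible_def by (rule someI_ex)
  then show "(mat z - A) ** resolvent A z = mat 1" "resolvent A z ** (mat z - A) = mat 1"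
    by auto
qed

lemma resolvent_holomorphic:
  fixes A :: "complex^'n^'n"
  shows "(\<lambda>z. resolvent A z $ i $ j) holomorphic_on (- mat_spectrum A)"
proof -
  define N where "N z = (\<chi> a b. if b = i then axis j 1 $ a else (mat z - A) $ a $ b)"
    for z :: complex
  have det: "(\<lambda>z. det (M z)) holomorphic_on S"
    if "\<And>a b. (\<lambda>z. M z $ a $ b) holomorphic_on S" for M :: "complex \<Rightarrow> complex^'n^'n" and S
    unfolding det_def
    by (intro holomorphic_on_sum holomorphic_on_mult holomorphic_on_const holomorphic_on_prod that)
  have ent: "(\<lambda>z. (mat z - A) $ a $ b) holomorphic_on S" for a b S
    by (cases "a = b") (auto simp: mat_def intro!: holomorphic_intros)
  have "(\<lambda>z. N z $ a $ b) holomorphic_on S" for a b S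
    using ent by (cases "b = i") (auto simp: N_def)
  then have "(\<lambda>z. det (N z) / det (mat z - A)) holomorphic_on (- mat_spectrum A)"
    using ent by (intro holomorphic_on_divide det) (auto simp: mat_spectrum_iff_det)
  moreover have "det (N z) / det (mat z - A) = resolvent A z $ i $ j"
    if "z \<in> - mat_spectrum A" for z
  proof -
    have "(mat z - A) *v (resolvent A z *v axis j 1) = axis j 1"
      using that by (simp add: matrix_vector_mul_assoc resolvent_mult)
    then have "(resolvent A z *v axis j 1) $ i = det (N z) / det (mat z - A)"
      using that cramer[of "mat z - A"] by (simp add: mat_spectrum_iff_det N_def)
    then show ?thesis
      by (simp add: matrix_vector_mult_def axis_def if_distrib cong: if_cong)
  qed
  ultimately show ?thesis
    by (subst (asm) holomorphic_cong[OF refl]) auto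
qed

lemma cauchy_fun_calc_residues:
  fixes A :: "complex^'n^'n"
  assumes \<Omega>: "open \<Omega>" "connected \<Omega>" and f: "f holomorphic_on \<Omega>"
    and \<gamma>: "surrounds \<gamma> (mat_spectrum A) \<Omega>"
  shows "cauchy_fun_calc \<gamma> f A =
    (\<chi> i j. \<Sum>p\<in>mat_spectrum A. residue (\<lambda>z. f z * resolvent A z $ i $ j) p)"
proof -
  have "contour_integral \<gamma> (\<lambda>z. f z * resolvent A z $ i $ j) = 2 * pi * \<i> *
     (\<Sum>p\<in>mat_spectrum A. winding_number \<gamma> p * residue (\<lambda>z. f z * resolvent A z $ i $ j) p)"
    for i j
  proof (rule Residue_theorem[OF \<Omega> finite_mat_spectrum])
    show "(\<lambda>z. f z * resolvent A z $ i $ j) holomorphic_on \<Omega> - mat_spectrum A"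
      by (intro holomorphic_on_mult holomorphic_on_subset[OF f]
          holomorphic_on_subset[OF resolvent_holomorphic]) auto
  qed (use \<gamma> in \<open>auto simp: surrounds_def\<close>)
  moreover have "(\<Sum>p\<in>mat_spectrum A. winding_number \<gamma> p * h p) = (\<Sum>p\<in>mat_spectrum A. h p)" for h
    using \<gamma> unfolding surrounds_def by (intro sum.cong) auto
  ultimately show ?thesis
    by (simp add: cauchy_fun_calc_def)
qed

lemma hol_fun_calc_eq:
  fixes A :: "complex^'n^'n"
  assumes \<Omega>: "open \<Omega>" "connected \<Omega>" and f: "f holomorphic_on \<Omega>"
    and \<gamma>: "surrounds \<gamma> (mat_spectrum A) \<Omega>"
  shows "hol_fun_calc \<Omega> f A = cauchy_fun_calc \<gamma> f A"
  unfolding hol_fun_calc_def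
  by (simp only: cauchy_fun_calc_residues[OF \<Omega> f \<gamma>]
      cauchy_fun_calc_residues[OF \<Omega> f someI[of "\<lambda>\<gamma>. surrounds \<gamma> (mat_spectrum A) \<Omega>", OF \<gamma>]])

definition htilde ::
    "(complex \<Rightarrow> complex) \<Rightarrow> (complex \<Rightarrow> complex) \<Rightarrow> nat \<Rightarrow> nat \<Rightarrow> complex \<Rightarrow> complex" where
  "htilde f g i j z =
     1 / (fact i * fact j) *
       ((deriv ^^ i) f z * (deriv ^^ j) g z - (deriv ^^ j) f z * (deriv ^^ i) g z)"

end

theory Submission
  imports Defs
begin

text \<open>
Put \<open>a\<^sub>k\<close> and \<open>b\<^sub>k\<close> for the Taylor coefficients of \<open>f\<close> and \<open>g\<close> at a point \<open>\<alpha>\<close>. The expression in the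
hypothesis is, up to sign, the Chow form of the twisted cubic: it vanishes at \<open>\<alpha>\<close> iff the span of
\<open>(a\<^sub>1, \<dots>, a\<^sub>4)\<close> and \<open>(b\<^sub>1, \<dots>, b\<^sub>4)\<close> is degenerate or contains a nonzero multiple of some
\<open>(1, s, s\<^sup>2, s\<^sup>3)\<close> or of \<open>(0, 0, 0, 1)\<close>. At a generic \<open>\<alpha>\<close> the two linear functionals spanning the
annihilator of \<open>a\<close> and \<open>b\<close> are therefore nowhere simultaneously zero, and in fact uniformly bounded
below, on the curve \<open>(1, s, s\<^sup>2, s\<^sup>3)\<close>, which is where the resolvent of a nilpotent matrix lives.

A nilpotent \<open>5 \<times> 5\<close> block \<open>N\<close> is chosen whose powers realise these functionals, multiplied by \<open>r\<^sup>3\<close>, in the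
entries \<open>(1,5)\<close> and \<open>(2,5)\<close>, all other entries being \<open>O(r\<^sup>2)\<close>. For \<open>B = \<alpha> + N\<close> the norms of \<open>f(B)\<close> and
\<open>g(B)\<close> are then \<open>O(r\<^sup>2)\<close>. Adding an entry of size \<open>\<delta> r\<^sup>3\<close> in a separate \<open>2 \<times> 2\<close> block gives \<open>A\<close>; its
resolvent is dominated by that of \<open>B\<close>, so the pseudospectra do not change, while \<open>f(A)\<close> and \<open>g(A)\<close>
grow like \<open>r\<^sup>3\<close>.
\<close>

section \<open>Functional calculus of nilpotent perturbations\<close>

lemma mat_mult_nth: "(mat c ** M) $ i $ j = c * (M $ i $ j :: complex)"
  for M :: "complex^'n^'n"
  by (simp add: matrix_matrix_mult_def mat_def if_distrib if_distribR cong: if_cong)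

lemma mult_mat_nth: "(M ** mat c) $ i $ j = c * (M $ i $ j :: complex)"
  for M :: "complex^'n^'n"
  by (simp add: matrix_matrix_mult_def mat_def if_distrib if_distribR mult.commute cong: if_cong)

lemma mat_mult_commute: "M ** mat c = mat c ** (M :: complex^'n^'n)"
  by (simp add: vec_eq_iff mat_mult_nth mult_mat_nth)

lemma mat_mult_mat: "mat c ** mat d = (mat (c * d) :: complex^'n^'n)"
  by (simp add: vec_eq_iff mat_mult_nth) (simp add: mat_def)

lemma matrix_mult_add_rdistrib: "(A + B) ** C = A ** C + B ** C"
  for A B :: "'a::semiring_1^'n^'m"
  by (simp add: vec_eq_iff matrix_matrix_mult_def distrib_right sum.distrib)

lemma matrix_mult_diff_rdistrib: "(A - B) ** C = A ** C - B ** C"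
  for A B :: "'a::ring_1^'n^'m"
  by (simp add: vec_eq_iff matrix_matrix_mult_def left_diff_distrib sum_subtractf)

primrec mpow :: "complex^'n^'n \<Rightarrow> nat \<Rightarrow> complex^'n^'n" where
  "mpow N 0 = mat 1"
| "mpow N (Suc k) = N ** mpow N k"

definition mpoly :: "nat \<Rightarrow> (nat \<Rightarrow> complex) \<Rightarrow> complex^'n^'n \<Rightarrow> complex^'n^'n" where
  "mpoly n c N = (\<Sum>k<n. mat (c k) ** mpow N k)"

lemma mpoly_nth: "mpoly n c N $ i $ j = (\<Sum>k<n. c k * mpow N k $ i $ j)"
  by (simp add: mpoly_def mat_mult_nth)

lemma mpow_eigenvector:
  assumes "N *v v = w *s v"
  shows "mpow N k *v v = w ^ k *s v"
proof (induction k)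
  case 0
  show ?case by (simp add: vec_eq_iff)
next
  case (Suc k)
  have "mpow N (Suc k) *v v = N *v (w ^ k *s v)"
    using Suc by (simp add: matrix_vector_mul_assoc[symmetric])
  also have "\<dots> = w ^ k *s (N *v v)"
    by (simp add: vec_eq_iff matrix_vector_mult_def sum_distrib_left mult_ac)
  finally show ?case
    using assms by (simp add: vec_eq_iff mult_ac)
qed

lemma mat_add_mult_vec: "(mat \<alpha> + N) *v v = \<alpha> *s v + N *v v" for N :: "complex^'n^'n"
proof -
  have "mat \<alpha> *v v = \<alpha> *s v"
    by (simp add: vec_eq_iff matrix_vector_mult_def mat_def if_distrib if_distribR cong: if_cong)
  then show ?thesis
    by (simp add: matrix_vector_mult_add_rdistrib)
qed

text \<open>If N has eigenvalue w, then \<open>mpow N n\<close> multiplies the eigenvector by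
  \<open>w ^ n\<close>, so w = 0. Conversely N has a nontrivial kernel, since otherwise all its
  powers would be injective.\<close>

lemma mat_spectrum_nilpotent:
  fixes N :: "complex^'n^'n"
  assumes "mpow N n = 0"
  shows "mat_spectrum (mat \<alpha> + N) = {\<alpha>}"
proof -
  have "z = \<alpha>" if "v \<noteq> 0" "(mat \<alpha> + N) *v v = z *s v" for z v
  proof -
    have "N *v v = (z - \<alpha>) *s v"
      using that unfolding mat_add_mult_vec by (simp add: vec_eq_iff algebra_simps)
    from mpow_eigenvector[OF this, of n] assms that show ?thesis
      by (auto simp: vec_eq_iff)
  qed
  moreover have "\<exists>v. v \<noteq> 0 \<and> N *v v = 0"
  proof (rule ccontr)
    assume *: "\<not> ?thesis"
    have "mpow N k *v v = 0 \<Longrightarrow> v = 0" for k and v :: "complex^'n"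
      by (induction k) (use * in \<open>auto simp: matrix_vector_mul_assoc[symmetric]\<close>)
    from this[of n "axis undefined 1"] assms show False
      by (auto simp: axis_eq_0_iff)
  qed
  ultimately show ?thesis
    by (auto simp: mat_spectrum_def mat_add_mult_vec)
qed

text \<open>Telescoping of a finite geometric series; the remainder disappears once
  \<open>mpow N n = 0\<close>.\<close>

lemma mult_mpoly_geometric:
  fixes N :: "complex^'n^'n"
  assumes "w \<noteq> 0"
  shows "(mat w - N) ** mpoly n (\<lambda>k. 1 / w ^ Suc k) N = mat 1 - mat (1 / w ^ n) ** mpow N n"
proof (induction n)
  case 0
  then show ?case by (simp add: mpoly_def)
next
  case (Suc n)
  let ?d = "mat (1 / w ^ Suc n)"
  have "mat w ** (?d ** mpow N n) = mat (1 / w ^ n) ** mpow N n"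
    using assms by (simp add: matrix_mul_assoc mat_mult_mat)
  moreover have "N ** (?d ** mpow N n) = ?d ** mpow N (Suc n)"
    unfolding mpow.simps matrix_mul_assoc mat_mult_commute[of N] ..
  ultimately have "(mat w - N) ** (?d ** mpow N n)
      = mat (1 / w ^ n) ** mpow N n - ?d ** mpow N (Suc n)"
    by (simp only: matrix_mult_diff_rdistrib)
  moreover have "mpoly (Suc n) (\<lambda>k. 1 / w ^ Suc k) N
      = mpoly n (\<lambda>k. 1 / w ^ Suc k) N + ?d ** mpow N n"
    by (simp only: mpoly_def sum.lessThan_Suc)
  ultimately show ?case
    using Suc by (simp only: matrix_add_ldistrib) (simp only: diff_add_cancel add_diff_eq)
qed

text \<open>The Neumann series terminates and yields a right inverse, which must equal the left
  inverse \<open>resolvent\<close>.\<close>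

lemma resolvent_nilpotent:
  fixes N :: "complex^'n^'n"
  assumes "mpow N n = 0" "z \<noteq> \<alpha>"
  shows "resolvent (mat \<alpha> + N) z = mpoly n (\<lambda>k. 1 / (z - \<alpha>) ^ Suc k) N"
proof -
  let ?A = "mat \<alpha> + N" and ?G = "mpoly n (\<lambda>k. 1 / (z - \<alpha>) ^ Suc k) N"
  have A: "mat z - ?A = mat (z - \<alpha>) - N"
    by (simp add: vec_eq_iff mat_def)
  have *: "(mat z - ?A) ** ?G = mat 1"
    unfolding A by (subst mult_mpoly_geometric) (use assms in simp_all)
  have "resolvent ?A z ** (mat z - ?A) = mat 1"
    by (rule resolvent_mult(2)) (simp add: mat_spectrum_nilpotent[OF assms(1)] assms(2))
  then have "?G = resolvent ?A z ** (mat z - ?A) ** ?G"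
    by simp
  also have "\<dots> = resolvent ?A z"
    unfolding matrix_mul_assoc[symmetric] * by simp
  finally show ?thesis
    by (rule sym)
qed

lemma residue_sum_over_power:
  assumes "open \<Omega>" "\<alpha> \<in> \<Omega>" "f holomorphic_on \<Omega>"
  shows "residue (\<lambda>z. \<Sum>k<n. c k * (f z / (z - \<alpha>) ^ Suc k)) \<alpha>
    = (\<Sum>k<n. c k * ((deriv ^^ k) f \<alpha> / fact k))"
proof (induction n)
  case 0
  show ?case by (simp add: residue_const)
next
  case (Suc n)
  have hol: "(\<lambda>z. c k * (f z / (z - \<alpha>) ^ Suc k)) holomorphic_on \<Omega> - {\<alpha>}" for k
    using assms by (intro holomorphic_intros holomorphic_on_subset[OF assms(3)]) auto
  have "residue (\<lambda>z. c n * (f z / (z - \<alpha>) ^ Suc n)) \<alpha> = c n * ((deriv ^^ n) f \<alpha> / fact n)"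
    unfolding residue_holomorphic_over_power[OF assms, symmetric]
    by (rule residue_lmul[OF assms(1,2)])
      (auto intro!: holomorphic_intros holomorphic_on_subset[OF assms(3)])
  moreover have "residue (\<lambda>z. (\<Sum>k<n. c k * (f z / (z - \<alpha>) ^ Suc k)) + c n * (f z / (z - \<alpha>) ^ Suc n)) \<alpha>
    = residue (\<lambda>z. \<Sum>k<n. c k * (f z / (z - \<alpha>) ^ Suc k)) \<alpha> + residue (\<lambda>z. c n * (f z / (z - \<alpha>) ^ Suc n)) \<alpha>"
    by (rule residue_add[OF assms(1,2)]) (intro holomorphic_on_sum hol)+
  ultimately show ?case
    using Suc by simp
qed

text \<open>The Cauchy integral reduces to the residue at \<alpha>, where each term of the
  terminating Neumann series contributes one Taylor coefficient of f.\<close>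

lemma hol_fun_calc_nilpotent:
  fixes N :: "complex^'n^'n"
  assumes \<Omega>: "open \<Omega>" "connected \<Omega>" "\<alpha> \<in> \<Omega>" and f: "f holomorphic_on \<Omega>"
    and N: "mpow N n = 0"
  shows "hol_fun_calc \<Omega> f (mat \<alpha> + N) = mpoly n (\<lambda>k. (deriv ^^ k) f \<alpha> / fact k) N"
proof -
  let ?A = "mat \<alpha> + N"
  have spec: "mat_spectrum ?A = {\<alpha>}"
    by (rule mat_spectrum_nilpotent[OF N])
  obtain \<gamma> where \<gamma>: "surrounds \<gamma> (mat_spectrum ?A) \<Omega>"
    using surrounds_exists[of \<Omega> "{\<alpha>}"] \<Omega> spec by auto
  have "residue (\<lambda>z. f z * resolvent ?A z $ i $ j) \<alpha>
      = residue (\<lambda>z. \<Sum>k<n. mpow N k $ i $ j * (f z / (z - \<alpha>) ^ Suc k)) \<alpha>" for i j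
  \<comment> \<open>The resolvent formula is available only for \<open>z \<noteq> \<alpha>\<close>;
    this suffices because a residue depends only on a punctured neighbourhood.\<close>
  proof (rule residue_cong[OF _ refl])
    show "\<forall>\<^sub>F z in at \<alpha>. f z * resolvent ?A z $ i $ j
        = (\<Sum>k<n. mpow N k $ i $ j * (f z / (z - \<alpha>) ^ Suc k))"
      unfolding eventually_at_filter
      by (intro always_eventually)
        (auto simp: resolvent_nilpotent[OF N] mpoly_nth sum_distrib_left intro!: sum.cong)
  qed
  then show ?thesis
    unfolding hol_fun_calc_eq[OF \<Omega>(1,2) f \<gamma>] cauchy_fun_calc_residues[OF \<Omega>(1,2) f \<gamma>]
    by (simp only: vec_eq_iff spec mpoly_nth residue_sum_over_power[OF \<Omega>(1,3) f])
      (simp add: mult.commute)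
qed

section \<open>Operator norms\<close>

lemma norm_mult_vec_le_opnorm: "norm (A *v v) \<le> opnorm A * norm v" for A :: "complex^'n^'n"
  unfolding opnorm_def by (rule onorm) simp

lemma opnorm_nonneg: "0 \<le> opnorm A" for A :: "complex^'n^'n"
  unfolding opnorm_def by (rule onorm_pos_le) simp

lemma opnorm_le:
  fixes A :: "complex^'n^'n"
  assumes "0 \<le> K" "\<And>v. norm (A *v v) ^ 2 \<le> K ^ 2 * norm v ^ 2"
  shows "opnorm A \<le> K"
  unfolding opnorm_def
proof (rule onorm_le)
  fix v
  show "norm (A *v v) \<le> K * norm v"
    by (rule power2_le_imp_le) (use assms in \<open>auto simp: power_mult_distrib\<close>)
qed

lemma norm_vec_power2: "norm v ^ 2 = (\<Sum>i\<in>UNIV. norm (v $ i) ^ 2)" for v :: "complex^'n"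
  by (simp add: norm_vec_def L2_set_def sum_nonneg)

lemma norm_mult_vec_power2_le: "norm (A *v v) ^ 2 \<le> opnorm A ^ 2 * norm v ^ 2" for A :: "complex^'n^'n"
  using power_mono[OF norm_mult_vec_le_opnorm[of A v], of 2] by (simp add: power_mult_distrib)

lemma mult_vec_axis_nth: "(A *v axis j x) $ i = A $ i $ j * x" for A :: "complex^'n^'n"
  by (simp add: matrix_vector_mult_def axis_def if_distrib cong: if_cong)

lemma entry_le_opnorm: "norm (A $ i $ j) \<le> opnorm A" for A :: "complex^'n^'n"
proof -
  have "A $ i $ j = (A *v axis j 1) $ i"
    by (simp add: mult_vec_axis_nth)
  also have "norm \<dots> \<le> norm (A *v axis j 1)"
    by (rule Finite_Cartesian_Product.norm_nth_le)
  also have "\<dots> \<le> opnorm A"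
    using norm_mult_vec_le_opnorm[of A "axis j 1"] by (simp add: norm_axis_1)
  finally show ?thesis .
qed

lemma exists_unit_aligning:
  fixes a b :: complex
  obtains \<theta> where "norm \<theta> = 1" "norm (a + \<theta> * b) = norm a + norm b"
proof (cases "a = 0 \<or> b = 0")
  case True
  then show ?thesis using that[of 1] by auto
next
  case False
  define \<theta> where "\<theta> = sgn a / sgn b"
  have "a + \<theta> * b = of_real (norm a + norm b) * sgn a"
    using False by (simp add: \<theta>_def sgn_eq field_simps)
  with False have "norm (a + \<theta> * b) = norm a + norm b"
    by (simp add: norm_mult norm_sgn flip: of_real_add)
  moreover have "norm \<theta> = 1"
    using False by (simp add: \<theta>_def norm_divide norm_sgn)
  ultimately show ?thesis using that by blast
qed

definition elem :: "'n \<Rightarrow> 'n \<Rightarrow> complex \<Rightarrow> complex^'n^'n" where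
  "elem a b x = (\<chi> i j. if i = a \<and> j = b then x else 0)"

lemma elem_mult_vec: "elem a b x *v v = axis a (x * v $ b)"
  by (auto simp: elem_def vec_eq_iff axis_def matrix_vector_mult_def if_distrib if_distribR
      cong: if_cong)

text \<open>The compression of X to the coordinates p, q is triangular with diagonal c. The norm of
  such a 2 x 2 block depends only on the moduli of its entries and grows with the corner entry, so
  the block with corner y is dominated by X.\<close>

lemma triangular_block_bound:
  fixes X :: "complex^'n^'n"
  assumes "p \<noteq> q" "X $ p $ p = c" "X $ q $ q = c" "X $ q $ p = 0" "norm y \<le> norm (X $ p $ q)"
  shows "norm (c * s + y * t) ^ 2 + norm (c * t) ^ 2
    \<le> opnorm X ^ 2 * (norm s ^ 2 + norm t ^ 2)"
proof -
  obtain \<theta> where \<theta>: "norm \<theta> = 1"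
    "norm (c * s + \<theta> * (X $ p $ q * t)) = norm (c * s) + norm (X $ p $ q * t)"
    by (rule exists_unit_aligning)
  \<comment> \<open>The phase \<theta> makes the two terms in row p of \<open>X *v v\<close> add
    without cancellation, without changing the norm of the vector.\<close>
  define v where "v = axis p s + axis q (\<theta> * t)"
  have v: "norm v ^ 2 = norm s ^ 2 + norm t ^ 2"
  proof -
    have "norm v ^ 2 = (\<Sum>i\<in>{p, q}. norm (v $ i) ^ 2)"
      unfolding norm_vec_power2
      by (rule sum.mono_neutral_right) (auto simp: v_def axis_def)
    then show ?thesis using assms(1) \<theta> by (simp add: v_def axis_def norm_mult)
  qed
  have Xv: "(X *v v) $ i = X $ i $ p * s + X $ i $ q * (\<theta> * t)" for i
    by (simp add: v_def matrix_vector_right_distrib mult_vec_axis_nth)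
  have "norm (c * s + y * t) \<le> norm ((X *v v) $ p)"
  proof -
    have "norm (c * s + y * t) \<le> norm (c * s) + norm y * norm t"
      by (metis norm_mult norm_triangle_ineq)
    also have "\<dots> \<le> norm (c * s) + norm (X $ p $ q) * norm t"
      using assms(5) by (simp add: mult_right_mono)
    also have "\<dots> = norm ((X *v v) $ p)"
      using \<theta>(2) by (simp add: Xv assms norm_mult mult_ac)
    finally show ?thesis .
  qed
  moreover have "norm (c * t) = norm ((X *v v) $ q)"
    using \<theta>(1) by (simp add: Xv assms norm_mult)
  ultimately have "norm (c * s + y * t) ^ 2 + norm (c * t) ^ 2
      \<le> (\<Sum>i\<in>{p, q}. norm ((X *v v) $ i) ^ 2)"
    using assms(1) by (simp add: power_mono)
  also have "\<dots> \<le> norm (X *v v) ^ 2"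
    unfolding norm_vec_power2 by (rule sum_mono2) auto
  also have "\<dots> \<le> opnorm X ^ 2 * norm v ^ 2"
    by (rule norm_mult_vec_power2_le)
  finally show ?thesis unfolding v .
qed

lemma norm_power2_add_axis2:
  fixes w :: "complex^'n"
  assumes "a \<noteq> b" "w $ a = 0" "w $ b = 0"
  shows "norm (w + axis a s + axis b t) ^ 2 = norm w ^ 2 + (norm s ^ 2 + norm t ^ 2)"
proof -
  have split: "norm u ^ 2 = (\<Sum>i\<in>UNIV - {a, b}. norm (u $ i) ^ 2) + (norm (u $ a) ^ 2 + norm (u $ b) ^ 2)"
    for u :: "complex^'n"
    unfolding norm_vec_power2 using assms(1) by (subst sum.subset_diff[of "{a, b}"]) auto
  have "(\<Sum>i\<in>UNIV - {a, b}. norm ((w + axis a s + axis b t) $ i) ^ 2)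
      = (\<Sum>i\<in>UNIV - {a, b}. norm (w $ i) ^ 2)"
    by (rule sum.cong) (auto simp: axis_def)
  then show ?thesis
    using assms by (simp add: split axis_def)
qed

lemma mult_vec_split_axis2:
  fixes X :: "complex^'n^'n" and v :: "complex^'n"
  assumes ab: "a \<noteq> b"
    and col: "X *v axis a (v $ a) = axis a (c * v $ a)" "X *v axis b (v $ b) = axis b (c * v $ b)"
    and row: "\<And>i. X $ a $ i = (if i = a then c else 0)" "\<And>i. X $ b $ i = (if i = b then c else 0)"
  obtains w where "norm v ^ 2 = norm w ^ 2 + (norm (v $ a) ^ 2 + norm (v $ b) ^ 2)"
    "X *v v = X *v w + axis a (c * v $ a) + axis b (c * v $ b)"
    "(X *v w) $ a = 0" "(X *v w) $ b = 0" "w $ b = 0"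
proof -
  define w where "w = (\<chi> i. if i = a \<or> i = b then 0 else v $ i)"
  have w: "w $ a = 0" "w $ b = 0"
    by (simp_all add: w_def)
  have v: "w + axis a (v $ a) + axis b (v $ b) = v"
    using ab by (auto simp: w_def vec_eq_iff axis_def)
  show ?thesis
  proof (rule that[OF _ _ _ _ w(2)])
    show "norm v ^ 2 = norm w ^ 2 + (norm (v $ a) ^ 2 + norm (v $ b) ^ 2)"
      using norm_power2_add_axis2[OF ab w, of "v $ a" "v $ b"] by (simp only: v)
    have "X *v v = X *v (w + axis a (v $ a) + axis b (v $ b))"
      by (simp only: v)
    then show "X *v v = X *v w + axis a (c * v $ a) + axis b (c * v $ b)"
      by (simp only: matrix_vector_right_distrib col)
    show "(X *v w) $ a = 0" "(X *v w) $ b = 0"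
      by (simp_all add: matrix_vector_mult_def row w if_distrib if_distribR cong: if_cong)
  qed
qed

text \<open>X is an orthogonal direct sum of c times the identity on the coordinates a, b and a
  remaining part. Adding y turns the scalar block into a triangular one, whose norm is already
  bounded by that of X through the larger entry (p,q).\<close>

lemma opnorm_add_elem:
  fixes X :: "complex^'n^'n"
  assumes ab: "a \<noteq> b"
    and col: "\<And>i. X $ i $ a = (if i = a then c else 0)" "\<And>i. X $ i $ b = (if i = b then c else 0)"
    and row: "\<And>i. X $ a $ i = (if i = a then c else 0)" "\<And>i. X $ b $ i = (if i = b then c else 0)"
    and pq: "p \<noteq> q" "X $ p $ p = c" "X $ q $ q = c" "X $ q $ p = 0" "norm y \<le> norm (X $ p $ q)"
  shows "opnorm (X + elem a b y) = opnorm X"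
proof (rule antisym)
  let ?Y = "X + elem a b y"
  have ax: "X *v axis a u = axis a (c * u)" "X *v axis b u = axis b (c * u)" for u
    by (simp_all only: vec_eq_iff mult_vec_axis_nth col) (simp_all add: axis_def)
  note split = mult_vec_split_axis2[OF ab ax row]
  have Y: "?Y *v v = X *v v + axis a (y * v $ b)" for v
    by (simp add: matrix_vector_mult_add_rdistrib elem_mult_vec)
  show "opnorm ?Y \<le> opnorm X"
  proof (rule opnorm_le[OF opnorm_nonneg])
    fix v
    obtain w where w: "norm v ^ 2 = norm w ^ 2 + (norm (v $ a) ^ 2 + norm (v $ b) ^ 2)"
      "X *v v = X *v w + axis a (c * v $ a) + axis b (c * v $ b)"
      "(X *v w) $ a = 0" "(X *v w) $ b = 0"
      by (rule split[of v])
    have "?Y *v v = X *v w + axis a (c * v $ a + y * v $ b) + axis b (c * v $ b)"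
      unfolding Y w(2) by (simp add: vec_eq_iff axis_def)
    then have "norm (?Y *v v) ^ 2 = norm (X *v w) ^ 2
        + (norm (c * v $ a + y * v $ b) ^ 2 + norm (c * v $ b) ^ 2)"
      by (simp only: norm_power2_add_axis2[OF ab w(3,4)])
    also have "\<dots> \<le> opnorm X ^ 2 * norm w ^ 2
        + opnorm X ^ 2 * (norm (v $ a) ^ 2 + norm (v $ b) ^ 2)"
      by (intro add_mono norm_mult_vec_power2_le triangular_block_bound[OF pq])
    finally show "norm (?Y *v v) ^ 2 \<le> opnorm X ^ 2 * norm v ^ 2"
      by (simp only: w(1) distrib_left)
  qed
  show "opnorm X \<le> opnorm ?Y"
  proof (rule opnorm_le[OF opnorm_nonneg])
    fix v
    obtain w where w: "norm v ^ 2 = norm w ^ 2 + (norm (v $ a) ^ 2 + norm (v $ b) ^ 2)"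
      "X *v v = X *v w + axis a (c * v $ a) + axis b (c * v $ b)"
      "(X *v w) $ a = 0" "(X *v w) $ b = 0" "w $ b = 0"
      by (rule split[of v])
    \<comment> \<open>For the reverse inequality: the diagonal entry c bounds the scalar block of X,
      and off the coordinates a, b the two matrices agree.\<close>
    have "?Y $ a $ a = c"
      using ab by (simp add: row elem_def)
    then have "norm c \<le> opnorm ?Y"
      using entry_le_opnorm[of ?Y a a] by simp
    then have c: "norm c ^ 2 \<le> opnorm ?Y ^ 2"
      by (rule power_mono) simp
    have Yw: "?Y *v w = X *v w"
      unfolding Y w(5) by (simp add: vec_eq_iff axis_def)
    have "norm (X *v v) ^ 2 = norm (?Y *v w) ^ 2
        + (norm (c * v $ a) ^ 2 + norm (c * v $ b) ^ 2)"
      unfolding w(2) Yw by (rule norm_power2_add_axis2[OF ab w(3,4)])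
    also have "\<dots> \<le> opnorm ?Y ^ 2 * norm w ^ 2
        + opnorm ?Y ^ 2 * (norm (v $ a) ^ 2 + norm (v $ b) ^ 2)"
      unfolding distrib_left norm_mult power_mult_distrib
      by (intro add_mono norm_mult_vec_power2_le mult_right_mono c) auto
    finally show "norm (X *v v) ^ 2 \<le> opnorm ?Y ^ 2 * norm v ^ 2"
      by (simp only: w(1) distrib_left)
  qed
qed

section \<open>The nilpotent matrices\<close>

lemma opnorm_add_le: "opnorm (A + B) \<le> opnorm A + opnorm B" for A B :: "complex^'n^'n"
  unfolding opnorm_def matrix_vector_mult_add_rdistrib by (rule onorm_triangle) simp_all

lemma opnorm_mat_le: "opnorm (mat c :: complex^'n^'n) \<le> norm c"
proof (rule opnorm_le)
  fix v :: "complex^'n"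
  have "mat c *v v = c *s v"
    by (simp add: vec_eq_iff matrix_vector_mult_def mat_def if_distrib if_distribR cong: if_cong)
  then show "norm (mat c *v v) ^ 2 \<le> norm c ^ 2 * norm v ^ 2"
    by (simp add: norm_vec_power2 norm_mult power_mult_distrib sum_distrib_left)
qed simp

lemma norm_axis: "norm (axis a x :: complex^'n) = norm x"
proof -
  have "norm (axis a x :: complex^'n) ^ 2 = norm x ^ 2"
    by (simp add: norm_vec_power2 axis_def if_distrib[of norm] if_distrib[of "\<lambda>y. y\<^sup>2"] cong: if_cong)
  then show ?thesis
    by simp
qed

lemma opnorm_elem_le: "opnorm (elem a b x) \<le> norm x"
proof (rule opnorm_le)
  fix v
  have "norm (axis a (x * v $ b)) \<le> norm x * norm v"
    using Finite_Cartesian_Product.norm_nth_le[of v b] by (simp add: norm_axis norm_mult mult_left_mono)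
  from power_mono[OF this, of 2] show "norm (elem a b x *v v) ^ 2 \<le> norm x ^ 2 * norm v ^ 2"
    by (simp add: elem_mult_vec power_mult_distrib)
qed simp

lemma elem_mult: "elem a b x ** elem c d y = (if b = c then elem a d (x * y) else 0)"
proof -
  have "(\<Sum>k\<in>UNIV. (if i = a \<and> k = b then x else 0) * (if k = c \<and> j = d then y else 0))
      = (\<Sum>k\<in>UNIV. if k = b then (if i = a \<and> b = c \<and> j = d then x * y else 0) else 0)" for i j
    by (rule sum.cong) auto
  then show ?thesis
    by (simp add: vec_eq_iff elem_def matrix_matrix_mult_def)
qed

lemma elem_0 [simp]: "elem a b 0 = 0"
  by (simp add: vec_eq_iff elem_def)

lemma elem_add: "elem a b (x + y) = elem a b x + elem a b y"
  by (simp add: vec_eq_iff elem_def)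

lemma mat_mult_elem: "mat c ** elem a b x = elem a b (c * x)"
  by (simp add: vec_eq_iff mat_mult_nth) (simp add: elem_def)

lemma matrix_mult_0_left [simp]: "0 ** A = 0"
  for A :: "'a::semiring_1^'n^'m"
  by (simp add: vec_eq_iff matrix_matrix_mult_def)

lemma matrix_mult_0_right [simp]: "A ** 0 = 0"
  for A :: "'a::semiring_1^'n^'m"
  by (simp add: vec_eq_iff matrix_matrix_mult_def)

text \<open>The strictly upper triangular matrices on the indices 1 to 5, padded by zeros to size
  10. Listing the ten entries as arguments reduces matrix algebra to rewriting.\<close>

definition upper ::
    "complex \<Rightarrow> complex \<Rightarrow> complex \<Rightarrow> complex \<Rightarrow> complex \<Rightarrow> complex \<Rightarrow> complex \<Rightarrow> complex \<Rightarrow> complex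
      \<Rightarrow> complex \<Rightarrow> complex^10^10" where
  "upper x12 x13 x14 x15 x23 x24 x25 x34 x35 x45 =
     elem 1 2 x12 + elem 1 3 x13 + elem 1 4 x14 + elem 1 5 x15 + elem 2 3 x23 + elem 2 4 x24
     + elem 2 5 x25 + elem 3 4 x34 + elem 3 5 x35 + elem 4 5 x45"

lemma upper_mult:
  "upper x12 x13 x14 x15 x23 x24 x25 x34 x35 x45 ** upper y12 y13 y14 y15 y23 y24 y25 y34 y35 y45
   = upper 0 (x12 * y23) (x12 * y24 + x13 * y34) (x12 * y25 + x13 * y35 + x14 * y45)
       0 (x23 * y34) (x23 * y35 + x24 * y45) 0 (x34 * y45) 0"
  unfolding upper_def
  by (simp add: matrix_add_ldistrib matrix_mult_add_rdistrib elem_mult elem_add)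

lemma upper_add:
  "upper x12 x13 x14 x15 x23 x24 x25 x34 x35 x45 + upper y12 y13 y14 y15 y23 y24 y25 y34 y35 y45
   = upper (x12 + y12) (x13 + y13) (x14 + y14) (x15 + y15) (x23 + y23) (x24 + y24) (x25 + y25)
       (x34 + y34) (x35 + y35) (x45 + y45)"
  unfolding upper_def by (simp add: elem_add)

lemma mat_mult_upper:
  "mat c ** upper x12 x13 x14 x15 x23 x24 x25 x34 x35 x45
   = upper (c * x12) (c * x13) (c * x14) (c * x15) (c * x23) (c * x24) (c * x25) (c * x34) (c * x35)
       (c * x45)"
  unfolding upper_def by (simp add: matrix_add_ldistrib mat_mult_elem)

lemma upper_mult_elem67: "upper x12 x13 x14 x15 x23 x24 x25 x34 x35 x45 ** elem 6 7 x = 0"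
  "elem 6 7 x ** upper x12 x13 x14 x15 x23 x24 x25 x34 x35 x45 = 0"
  unfolding upper_def by (simp_all add: matrix_add_ldistrib matrix_mult_add_rdistrib elem_mult)

lemma upper_zero: "upper 0 0 0 0 0 0 0 0 0 0 = 0"
  unfolding upper_def by simp

lemma opnorm_upper_le:
  "opnorm (upper x12 x13 x14 x15 x23 x24 x25 x34 x35 x45)
   \<le> norm x12 + norm x13 + norm x14 + norm x15 + norm x23 + norm x24 + norm x25 + norm x34
     + norm x35 + norm x45"
  unfolding upper_def by (intro order.trans[OF opnorm_add_le] add_mono opnorm_elem_le)

text \<open>The entry \<open>(i,j)\<close> scales like \<open>r\<close> to the power \<open>d\<^sub>j - d\<^sub>i\<close> with \<open>d = (0, 0, 1, 2, 3)\<close>; the coefficients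
  are solved for so that in \<open>\<Sum>\<^sub>k c\<^sub>k N\<^sup>k\<close> the entries \<open>(1,5)\<close> and \<open>(2,5)\<close> become
  \<open>r\<^sup>3 (l\<^sub>1 c\<^sub>1 + l\<^sub>2 c\<^sub>2 + c\<^sub>4)\<close> and \<open>r\<^sup>3 (m\<^sub>1 c\<^sub>1 + m\<^sub>2 c\<^sub>2 + c\<^sub>3)\<close>.\<close>

definition nilp :: "complex \<Rightarrow> complex \<Rightarrow> complex \<Rightarrow> complex \<Rightarrow> complex \<Rightarrow> complex^10^10" where
  "nilp l1 l2 m1 m2 r =
     upper 1 (- m2 * r) ((l2 - m1 + m2\<^sup>2) * r\<^sup>2) (l1 * r ^ 3) r 0 (m1 * r ^ 3) r (m2 * r\<^sup>2) r"

lemma mpow_nilp: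
  fixes l1 l2 m1 m2 r :: complex
  defines "N \<equiv> nilp l1 l2 m1 m2 r"
  shows "mpow N 2 = upper 0 r (- m2 * r\<^sup>2) (l2 * r ^ 3) 0 (r\<^sup>2) (m2 * r ^ 3) 0 (r\<^sup>2) 0"
    and "mpow N 3 = upper 0 0 (r\<^sup>2) 0 0 0 (r ^ 3) 0 0 0"
    and "mpow N 4 = upper 0 0 0 (r ^ 3) 0 0 0 0 0 0"
    and "mpow N 5 = 0"
proof -
  note eqs = N_def nilp_def upper_mult upper_zero
  have "mpow N 2 = N ** N"
    by (simp add: eval_nat_numeral)
  then show 2: "mpow N 2 = upper 0 r (- m2 * r\<^sup>2) (l2 * r ^ 3) 0 (r\<^sup>2) (m2 * r ^ 3) 0 (r\<^sup>2) 0"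
    by (simp add: eqs algebra_simps power2_eq_square power3_eq_cube)
  have "mpow N 3 = N ** mpow N 2"
    by (simp add: eval_nat_numeral)
  also have "\<dots> = upper 0 0 (r\<^sup>2) 0 0 0 (r ^ 3) 0 0 0"
    unfolding 2 unfolding eqs by (simp add: eqs algebra_simps power2_eq_square power3_eq_cube)
  finally show 3: "mpow N 3 = upper 0 0 (r\<^sup>2) 0 0 0 (r ^ 3) 0 0 0" .
  have "mpow N 4 = N ** mpow N 3"
    by (simp add: eval_nat_numeral)
  also have "\<dots> = upper 0 0 0 (r ^ 3) 0 0 0 0 0 0"
    unfolding 3 unfolding eqs by (simp add: eqs algebra_simps power2_eq_square power3_eq_cube)
  finally show 4: "mpow N 4 = upper 0 0 0 (r ^ 3) 0 0 0 0 0 0" .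
  have "mpow N 5 = N ** mpow N 4"
    by (simp add: eval_nat_numeral)
  also have "\<dots> = 0"
    unfolding 4 unfolding eqs by (simp add: eqs algebra_simps power2_eq_square power3_eq_cube)
  finally show "mpow N 5 = 0" .
qed

lemma mpoly_5:
  "mpoly 5 c N = mat (c 0) + (mat (c 1) ** N + mat (c 2) ** mpow N 2 + mat (c 3) ** mpow N 3
    + mat (c 4) ** mpow N 4)"
proof -
  have "{..<5::nat} = {0, 1, 2, 3, 4}" by auto
  then show ?thesis
    by (simp add: mpoly_def add.assoc)
qed

text \<open>Only (1,5) and (2,5) carry the factor \<open>r ^ 3\<close>, and they hold the two linear
  functionals evaluated at c; every other entry has a power of r at most 2.\<close>

lemma mpoly_nilp:
  "mpoly 5 c (nilp l1 l2 m1 m2 r) = mat (c 0) +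
     upper (c 1) ((c 2 - c 1 * m2) * r) ((c 1 * (l2 - m1 + m2\<^sup>2) - c 2 * m2 + c 3) * r\<^sup>2)
       ((c 1 * l1 + c 2 * l2 + c 4) * r ^ 3) (c 1 * r) (c 2 * r\<^sup>2)
       ((c 1 * m1 + c 2 * m2 + c 3) * r ^ 3) (c 1 * r) ((c 1 * m2 + c 2) * r\<^sup>2) (c 1 * r)"
  unfolding mpoly_5 mpow_nilp unfolding nilp_def mat_mult_upper upper_add
  by (simp add: algebra_simps)

text \<open>The extra entry squares to zero and annihilates the 5 x 5 block from both sides, so it
  is visible only in the first power.\<close>

lemma mpow_nilp_add_elem:
  fixes l1 l2 m1 m2 r t :: complex
  defines "N \<equiv> nilp l1 l2 m1 m2 r"
  shows "mpow (N + elem 6 7 t) (Suc (Suc k)) = mpow N (Suc (Suc k))"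
proof (induction k)
  case 0
  show ?case
    by (simp add: N_def nilp_def matrix_add_ldistrib matrix_mult_add_rdistrib upper_mult_elem67 elem_mult)
next
  case (Suc k)
  have "elem 6 7 t ** N = 0"
    by (simp add: N_def nilp_def upper_mult_elem67)
  then have "elem 6 7 t ** (N ** X) = 0" for X
    by (simp add: matrix_mul_assoc)
  with Suc show ?case
    by (simp add: matrix_mult_add_rdistrib)
qed

lemma mpoly_nilp_add_elem:
  fixes l1 l2 m1 m2 r t :: complex
  defines "N \<equiv> nilp l1 l2 m1 m2 r"
  shows "mpoly 5 c (N + elem 6 7 t) = mpoly 5 c N + elem 6 7 (c 1 * t)"
  using mpow_nilp_add_elem[of l1 l2 m1 m2 r t 0] mpow_nilp_add_elem[of l1 l2 m1 m2 r t 1]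
    mpow_nilp_add_elem[of l1 l2 m1 m2 r t 2]
  unfolding mpoly_5 N_def
  by (simp add: eval_nat_numeral matrix_add_ldistrib mat_mult_elem del: mpow.simps)

lemma opnorm_mpoly_nilp_add_elem:
  assumes "norm (c 1 * t) \<le> norm ((c 1 * l1 + c 2 * l2 + c 4) * r ^ 3)
    \<or> norm (c 1 * t) \<le> norm ((c 1 * m1 + c 2 * m2 + c 3) * r ^ 3)"
  shows "opnorm (mpoly 5 c (nilp l1 l2 m1 m2 r + elem 6 7 t)) = opnorm (mpoly 5 c (nilp l1 l2 m1 m2 r))"
proof -
  let ?X = "mpoly 5 c (nilp l1 l2 m1 m2 r)"
  note eqs = mpoly_nilp upper_def elem_def mat_def
  \<comment> \<open>The dominating entry sits in column 5 and in row 1 or 2, according to which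
    functional is large.\<close>
  have "\<exists>p. p \<noteq> 5 \<and> ?X $ p $ p = c 0 \<and> ?X $ 5 $ p = 0 \<and> norm (c 1 * t) \<le> norm (?X $ p $ 5)"
    using assms
  proof
    assume "norm (c 1 * t) \<le> norm ((c 1 * l1 + c 2 * l2 + c 4) * r ^ 3)"
    then show ?thesis by (intro exI[of _ 1]) (simp add: eqs)
  next
    assume "norm (c 1 * t) \<le> norm ((c 1 * m1 + c 2 * m2 + c 3) * r ^ 3)"
    then show ?thesis by (intro exI[of _ 2]) (simp add: eqs)
  qed
  then obtain p where p: "p \<noteq> 5" "?X $ p $ p = c 0" "?X $ 5 $ p = 0"
    "norm (c 1 * t) \<le> norm (?X $ p $ 5)"
    by blast
  show ?thesis
    unfolding mpoly_nilp_add_elem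
    by (rule opnorm_add_elem[OF _ _ _ _ _ p(1,2) _ p(3,4)]) (auto simp: eqs)
qed

text \<open>If both functionals vanish at c, the \<open>r ^ 3\<close> entries are zero and the rest
  is of order at most \<open>r\<^sup>2\<close>.\<close>

lemma opnorm_mpoly_nilp_bound:
  assumes "c 1 * l1 + c 2 * l2 + c 4 = 0" "c 1 * m1 + c 2 * m2 + c 3 = 0"
  shows "\<exists>K. \<forall>r\<ge>1. opnorm (mpoly 5 c (nilp l1 l2 m1 m2 (of_real r))) \<le> K * r\<^sup>2"
proof -
  define d2 d3 d4 where "d2 = c 2 - c 1 * m2" and "d3 = c 1 * (l2 - m1 + m2\<^sup>2) - c 2 * m2 + c 3"
    and "d4 = c 1 * m2 + c 2"
  \<comment> \<open>The summands follow the argument order of \<open>upper\<close>; the two zeros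
    stand for the entries (1,5) and (2,5).\<close>
  define K where "K = norm (c 0) + (norm (c 1) + norm d2 + norm d3 + 0 + norm (c 1) + norm (c 2) + 0
    + norm (c 1) + norm d4 + norm (c 1))"
  show ?thesis
  proof (intro exI[of _ K] allI impI)
    fix r :: real
    assume r: "1 \<le> r"
    have le: "norm (d * of_real r ^ k) \<le> norm d * r\<^sup>2" if "k \<le> 2" for d :: complex and k
      using r power_increasing[OF that r] by (simp add: norm_mult norm_power mult_left_mono)
    have "opnorm (mpoly 5 c (nilp l1 l2 m1 m2 (of_real r)))
      \<le> norm (c 0) + (norm (c 1) + norm (d2 * of_real r) + norm (d3 * (of_real r)\<^sup>2) + norm (0 :: complex)
        + norm (c 1 * of_real r) + norm (c 2 * (of_real r)\<^sup>2) + norm (0 :: complex) + norm (c 1 * of_real r)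
        + norm (d4 * (of_real r)\<^sup>2) + norm (c 1 * of_real r))"
      unfolding mpoly_nilp assms d2_def d3_def d4_def mult_zero_left
      by (intro order.trans[OF opnorm_add_le] add_mono opnorm_mat_le opnorm_upper_le)
    also have "\<dots> \<le> norm (c 0) * r\<^sup>2 + (norm (c 1) * r\<^sup>2 + norm d2 * r\<^sup>2 + norm d3 * r\<^sup>2 + 0 * r\<^sup>2
        + norm (c 1) * r\<^sup>2 + norm (c 2) * r\<^sup>2 + 0 * r\<^sup>2 + norm (c 1) * r\<^sup>2
        + norm d4 * r\<^sup>2 + norm (c 1) * r\<^sup>2)"
      using le[of 0 "c 0"] le[of 0 "c 1"] le[of 1 "c 1"] le[of 1 d2]
      by (intro add_mono le) simp_all
    also have "\<dots> = K * r\<^sup>2"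
      unfolding K_def by (simp only: distrib_right)
    finally show "opnorm (mpoly 5 c (nilp l1 l2 m1 m2 (of_real r))) \<le> K * r\<^sup>2" .
  qed
qed

section \<open>The Chow form and generic base points\<close>

text \<open>Outside a large disc q alone has modulus at least 1, having positive degree; on the disc
  the larger of the two moduli attains a positive minimum by compactness.\<close>

lemma poly_pair_bounded_below:
  fixes p q :: "complex poly"
  assumes "degree q > 0" "\<And>s. \<not> (poly p s = 0 \<and> poly q s = 0)"
  obtains \<delta> where "\<delta> > 0" "\<And>s. \<delta> \<le> norm (poly p s) \<or> \<delta> \<le> norm (poly q s)"
proof -
  define \<phi> where "\<phi> s = max (norm (poly p s)) (norm (poly q s))" for s
  have "filterlim (\<lambda>z. norm (poly q z)) at_top at_infinity"
    by (rule filterlim_at_infinity_imp_norm_at_top[OF filterlim_poly_at_infinity[OF assms(1)]])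
  then obtain b where b: "\<And>z. b \<le> norm z \<Longrightarrow> 1 \<le> norm (poly q z)"
    unfolding filterlim_at_top eventually_at_infinity by blast
  \<comment> \<open>The absolute value keeps the disc nonempty even if b is negative.\<close>
  have "continuous_on (cball 0 \<bar>b\<bar>) \<phi>"
    unfolding \<phi>_def by (intro continuous_intros)
  then obtain s0 where s0: "\<forall>s\<in>cball 0 \<bar>b\<bar>. \<phi> s0 \<le> \<phi> s"
    using continuous_attains_inf[of "cball 0 \<bar>b\<bar>" \<phi>] by auto
  show ?thesis
  proof
    show "min 1 (\<phi> s0) > 0"
      using assms(2)[of s0] by (auto simp: \<phi>_def less_max_iff_disj)
    show "min 1 (\<phi> s0) \<le> norm (poly p s) \<or> min 1 (\<phi> s0) \<le> norm (poly q s)" for s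
      using s0[rule_format, of s] b[of s] by (cases "norm s \<le> \<bar>b\<bar>") (auto simp: \<phi>_def le_max_iff_disj min_le_iff_disj)
  qed
qed

text \<open>The functions \<open>htilde f g i j\<close> are the 2 x 2 minors of the two rows of
  Taylor coefficients of f and g; this is their quadratic relation.\<close>

lemma htilde_Pluecker:
  "htilde f g i j z * htilde f g k l z - htilde f g i k z * htilde f g j l z
    + htilde f g i l z * htilde f g j k z = 0"
  unfolding htilde_def by (simp add: field_simps) 

definition chow :: "(complex \<Rightarrow> complex) \<Rightarrow> (complex \<Rightarrow> complex) \<Rightarrow> complex \<Rightarrow> complex" where
  "chow f g z = (let h = htilde f g in
        h 1 2 z * ((h 2 4 z)^2 - h 3 4 z * (2 * h 2 3 z + h 1 4 z))
      + h 1 3 z * (h 1 3 z * h 3 4 z - h 2 3 z * h 2 4 z)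
      + (h 2 3 z)^3)"

text \<open>The two polynomials in s are the annihilating functionals, scaled by
  \<open>htilde f g 1 2 z\<close>, on the curve (1, s, s^2, s^3). A common root expresses the minors
  23 and 24 through 12, 13, 14 and s, the Pluecker relation does the same for 34, and then
  \<open>chow\<close> vanishes identically.\<close>

lemma no_common_root:
  assumes "chow f g z \<noteq> 0" "htilde f g 1 2 z \<noteq> 0"
  shows "\<not> (htilde f g 2 3 z - htilde f g 1 3 z * s + htilde f g 1 2 z * s\<^sup>2 = 0
    \<and> htilde f g 2 4 z - htilde f g 1 4 z * s + htilde f g 1 2 z * s ^ 3 = 0)"
proof
  define h where "h i j = htilde f g i j z" for i j
  assume "htilde f g 2 3 z - htilde f g 1 3 z * s + htilde f g 1 2 z * s\<^sup>2 = 0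
    \<and> htilde f g 2 4 z - htilde f g 1 4 z * s + htilde f g 1 2 z * s ^ 3 = 0"
  then have h23: "h 2 3 = h 1 3 * s - h 1 2 * s\<^sup>2" and h24: "h 2 4 = h 1 4 * s - h 1 2 * s ^ 3"
    by (auto simp: h_def algebra_simps eq_diff_eq)
  have "h 1 2 * h 3 4 - h 1 3 * h 2 4 + h 1 4 * h 2 3 = 0"
    unfolding h_def by (rule htilde_Pluecker)
  then have "h 1 2 * h 3 4 = h 1 2 * (h 1 4 * s\<^sup>2 - h 1 3 * s ^ 3)"
    unfolding h23 h24 by algebra
  then have h34: "h 3 4 = h 1 4 * s\<^sup>2 - h 1 3 * s ^ 3"
    using assms(2) by (simp add: h_def)
  have "chow f g z = h 1 2 * ((h 2 4)^2 - h 3 4 * (2 * h 2 3 + h 1 4))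
      + h 1 3 * (h 1 3 * h 3 4 - h 2 3 * h 2 4) + (h 2 3)^3"
    by (simp add: chow_def h_def Let_def)
  also have "\<dots> = 0"
    unfolding h23 h24 h34 by algebra
  finally show False
    using assms(1) by simp
qed

lemma higher_deriv_zero_on:
  assumes "open S" "\<And>z. z \<in> S \<Longrightarrow> deriv f z = 0" "z \<in> S"
  shows "(deriv ^^ Suc n) f z = 0"
  using assms(3)
proof (induction n arbitrary: z)
  case 0
  then show ?case using assms(2) by simp
next
  case (Suc n)
  have "(deriv ^^ Suc (Suc n)) f z = deriv (\<lambda>_. 0) z"
    unfolding funpow.simps(2)[of "Suc n" deriv] o_apply
    by (rule deriv_cong_ev) (use Suc assms(1) in \<open>auto simp: eventually_nhds intro!: exI[of _ S]\<close>)
  then show ?case by simp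
qed

text \<open>If one first derivative vanished on all of U, so would its higher derivatives, hence
  every minor with positive indices and \<open>chow\<close> itself.\<close>

lemma deriv_not_zero_on:
  assumes "open U" "U \<noteq> {}" "\<And>z. z \<in> U \<Longrightarrow> chow f g z \<noteq> 0"
  shows "\<exists>z\<in>U. deriv f z \<noteq> 0" "\<exists>z\<in>U. deriv g z \<noteq> 0"
proof -
  obtain z where z: "z \<in> U" using assms(2) by blast
  have *: "chow f g z = 0" if "\<And>i j. i > 0 \<Longrightarrow> j > 0 \<Longrightarrow> htilde f g i j z = 0"
    using that by (simp add: chow_def Let_def)
  have "htilde f g i j z = 0"
    if "(\<forall>z\<in>U. deriv f z = 0) \<or> (\<forall>z\<in>U. deriv g z = 0)" "i > 0" "j > 0" for i j
    using that(1)
  proof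
    assume "\<forall>z\<in>U. deriv f z = 0"
    then show ?thesis
      using higher_deriv_zero_on[OF assms(1), of f z "i - 1"] z that
        higher_deriv_zero_on[OF assms(1), of f z "j - 1"] by (simp add: htilde_def del: funpow.simps)
  next
    assume "\<forall>z\<in>U. deriv g z = 0"
    then show ?thesis
      using higher_deriv_zero_on[OF assms(1), of g z "i - 1"] z that
        higher_deriv_zero_on[OF assms(1), of g z "j - 1"] by (simp add: htilde_def del: funpow.simps)
  qed
  with * assms(3)[OF z] show "\<exists>z\<in>U. deriv f z \<noteq> 0" "\<exists>z\<in>U. deriv g z \<noteq> 0"
    by blast+
qed

text \<open>The minor 12 is half the Wronskian of f' and g', and its derivative is a multiple of the
  minor 13. If 12 vanished on U, so would 13, and \<open>chow\<close> would reduce to the cube of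
  the minor 23, which is then nonzero. A linear relation between these minors forces f' = 0 on U, a
  contradiction.\<close>

lemma htilde_12_not_zero_on:
  assumes U: "open U" "U \<noteq> {}" and hol: "f holomorphic_on U" "g holomorphic_on U"
    and chow: "\<And>z. z \<in> U \<Longrightarrow> chow f g z \<noteq> 0"
  shows "\<exists>z\<in>U. htilde f g 1 2 z \<noteq> 0"
proof (rule ccontr)
  assume "\<not> ?thesis"
  then have h12: "htilde f g 1 2 z = 0" if "z \<in> U" for z
    using that by blast
  have D: "((deriv ^^ n) F has_field_derivative (deriv ^^ Suc n) F z) (at z)"
    if "z \<in> U" "F holomorphic_on U" for n z F
    using holomorphic_derivI[OF holomorphic_higher_deriv[OF that(2) U(1)] U(1) that(1)] by simp
  have h13: "htilde f g 1 3 z = 0" if z: "z \<in> U" for z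
  proof -
    let ?w = "\<lambda>z. (deriv ^^ 1) f z * (deriv ^^ 2) g z - (deriv ^^ 2) f z * (deriv ^^ 1) g z"
    have w0: "?w z = 0" if "z \<in> U" for z
      using h12[OF that] by (simp add: htilde_def)
    have "(?w has_field_derivative
        (deriv ^^ 1) f z * (deriv ^^ 3) g z - (deriv ^^ 3) f z * (deriv ^^ 1) g z) (at z)"
      using D[OF z hol(1), of 1] D[OF z hol(1), of 2] D[OF z hol(2), of 1] D[OF z hol(2), of 2]
      unfolding eval_nat_numeral
      by (auto intro!: derivative_eq_intros simp: algebra_simps)
    moreover have "(?w has_field_derivative 0) (at z)"
      by (rule has_field_derivative_transform_within_open[of "\<lambda>_. 0" _ _ U]) (use z U w0 in auto)
    ultimately show ?thesis
      using DERIV_unique by (fastforce simp: htilde_def)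
  qed
  have h23: "htilde f g 2 3 z \<noteq> 0" if "z \<in> U" for z
    using chow[OF that] h12[OF that] h13[OF that] by (auto simp: chow_def Let_def)
  have "deriv f z = 0" if "z \<in> U" for z
  proof -
    let ?f = "\<lambda>i. (deriv ^^ i) f z / fact i" and ?g = "\<lambda>i. (deriv ^^ i) g z / fact i"
    have h: "htilde f g i j z = ?f i * ?g j - ?f j * ?g i" for i j
      by (simp add: htilde_def field_simps)
    \<comment> \<open>Expansion of a 3 x 3 determinant in which the row of f occurs twice.\<close>
    have "?f 1 * htilde f g 2 3 z = ?f 2 * htilde f g 1 3 z - ?f 3 * htilde f g 1 2 z"
      unfolding h by algebra
    then show ?thesis
      using h12[OF that] h13[OF that] h23[OF that] by simp
  qed
  then show False
    using deriv_not_zero_on(1)[OF U chow] by blast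
qed

lemma continuous_nonzero_shrink:
  fixes h :: "'a::topological_space \<Rightarrow> 'b::t1_space"
  assumes "open U" "continuous_on U h" "\<exists>z\<in>U. h z \<noteq> c"
  shows "\<exists>V. open V \<and> V \<noteq> {} \<and> V \<subseteq> U \<and> (\<forall>z\<in>V. h z \<noteq> c)"
proof (intro exI conjI)
  show "open (U \<inter> h -` (- {c}))"
    using continuous_on_open_vimage[OF assms(1), of h] assms(2) by (simp add: open_Compl inf_commute)
qed (use assms(3) in auto)

lemma htilde_holomorphic_on:
  assumes "open S" "f holomorphic_on S" "g holomorphic_on S"
  shows "htilde f g i j holomorphic_on S"
proof -
  have "(deriv ^^ n) f holomorphic_on S" "(deriv ^^ n) g holomorphic_on S" for n
    using assms by (simp_all add: holomorphic_higher_deriv)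
  then show ?thesis
    unfolding htilde_def[abs_def]
    by (intro holomorphic_on_mult holomorphic_on_diff holomorphic_on_const)
qed

lemma chow_holomorphic_on:
  assumes "open S" "f holomorphic_on S" "g holomorphic_on S"
  shows "chow f g holomorphic_on S"
  unfolding chow_def[abs_def] Let_def
  by (intro holomorphic_on_add holomorphic_on_mult holomorphic_on_diff holomorphic_on_power
      holomorphic_on_const htilde_holomorphic_on assms)

text \<open>The conditions are secured one after another on shrinking open sets, because each
  nonvanishing argument needs \<open>chow\<close> to be nonzero throughout an open set.\<close>

lemma obtains_base_point:
  assumes \<Omega>: "open \<Omega>" and hol: "f holomorphic_on \<Omega>" "g holomorphic_on \<Omega>"
    and "\<exists>z\<in>\<Omega>. chow f g z \<noteq> 0"
  obtains \<alpha> where "\<alpha> \<in> \<Omega>" "chow f g \<alpha> \<noteq> 0" "htilde f g 1 2 \<alpha> \<noteq> 0" "deriv f \<alpha> \<noteq> 0" "deriv g \<alpha> \<noteq> 0"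
proof -
  have "chow f g holomorphic_on \<Omega>"
    by (rule chow_holomorphic_on[OF \<Omega> hol])
  from continuous_nonzero_shrink[OF \<Omega> holomorphic_on_imp_continuous_on[OF this] assms(4)]
  obtain U where U: "open U" "U \<noteq> {}" "U \<subseteq> \<Omega>" "\<forall>z\<in>U. chow f g z \<noteq> 0"
    by (elim exE conjE)
  have holU: "f holomorphic_on U" "g holomorphic_on U"
    using hol U(3) by (simp_all add: holomorphic_on_subset)
  have "\<exists>z\<in>U. htilde f g 1 2 z \<noteq> 0"
    by (rule htilde_12_not_zero_on[OF U(1,2) holU]) (simp add: U(4))
  from continuous_nonzero_shrink[OF U(1)
      holomorphic_on_imp_continuous_on[OF htilde_holomorphic_on[OF U(1) holU]] this]
  obtain V where V: "open V" "V \<noteq> {}" "V \<subseteq> U" "\<forall>z\<in>V. htilde f g 1 2 z \<noteq> 0"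
    by (elim exE conjE)
  have chow_V: "chow f g z \<noteq> 0" if "z \<in> V" for z
    using U(4) V(3) that by (simp add: subset_iff)
  have deriv_V: "deriv f holomorphic_on V"
    using holomorphic_deriv[OF holU(1) U(1)] V(3) by (rule holomorphic_on_subset)
  have "\<exists>z\<in>V. deriv f z \<noteq> 0"
    by (rule deriv_not_zero_on(1)[OF V(1,2)]) (rule chow_V)
  from continuous_nonzero_shrink[OF V(1) holomorphic_on_imp_continuous_on[OF deriv_V] this]
  obtain W where W: "open W" "W \<noteq> {}" "W \<subseteq> V" "\<forall>z\<in>W. deriv f z \<noteq> 0"
    by (elim exE conjE)
  have "\<exists>z\<in>W. deriv g z \<noteq> 0"
    by (rule deriv_not_zero_on(2)[OF W(1,2), of f]) (use chow_V W(3) in \<open>simp add: subset_iff\<close>)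
  then obtain \<alpha> where \<alpha>: "\<alpha> \<in> W" "deriv g \<alpha> \<noteq> 0"
    by (elim bexE)
  have "\<alpha> \<in> V" "\<alpha> \<in> \<Omega>"
    using \<alpha> U(3) V(3) W(3) by auto
  then show ?thesis
    by (intro that[of \<alpha>]) (use \<alpha> V(4) W(4) chow_V in simp_all)
qed

section \<open>Matrices with identical pseudospectra\<close>

lemma exists_annihilating_pair:
  assumes "chow f g \<alpha> \<noteq> 0" "htilde f g 1 2 \<alpha> \<noteq> 0"
  defines "a \<equiv> \<lambda>k. (deriv ^^ k) f \<alpha> / fact k" and "b \<equiv> \<lambda>k. (deriv ^^ k) g \<alpha> / fact k"
  obtains l1 l2 m1 m2 \<delta> where
    "a 1 * l1 + a 2 * l2 + a 4 = 0" "a 1 * m1 + a 2 * m2 + a 3 = 0"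
    "b 1 * l1 + b 2 * l2 + b 4 = 0" "b 1 * m1 + b 2 * m2 + b 3 = 0"
    "\<delta> > 0" "\<forall>s. \<delta> \<le> norm (l1 + l2 * s + s ^ 3) \<or> \<delta> \<le> norm (m1 + m2 * s + s\<^sup>2)"
proof -
  define h where "h i j = htilde f g i j \<alpha>" for i j
  have h: "h i j = a i * b j - a j * b i" for i j
    by (simp add: h_def htilde_def a_def b_def field_simps)
  have h12: "h 1 2 \<noteq> 0"
    using assms by (simp add: h_def)
  \<comment> \<open>Cramer's rule for the two linear systems with determinant
    \<open>h 1 2\<close>.\<close>
  define l1 l2 m1 m2 where lm: "l1 = h 2 4 / h 1 2" "l2 = - h 1 4 / h 1 2"
    "m1 = h 2 3 / h 1 2" "m2 = - h 1 3 / h 1 2"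
  have 0: "c 1 * l1 + c 2 * l2 + c 4 = 0 \<and> c 1 * m1 + c 2 * m2 + c 3 = 0" if "c = a \<or> c = b" for c
  proof -
    have "c 1 * h 2 4 - c 2 * h 1 4 + c 4 * h 1 2 = 0" "c 1 * h 2 3 - c 2 * h 1 3 + c 3 * h 1 2 = 0"
      using that unfolding h by (auto simp: algebra_simps)
    then show ?thesis
      using h12 by (simp add: lm field_simps)
  qed
  have P: "poly [:l1, l2, 0, 1:] s = l1 + l2 * s + s ^ 3" "poly [:m1, m2, 1:] s = m1 + m2 * s + s\<^sup>2" for s
    by (simp_all add: algebra_simps power2_eq_square power3_eq_cube)
  have "\<not> (poly [:l1, l2, 0, 1:] s = 0 \<and> poly [:m1, m2, 1:] s = 0)" for s
  proof -
    have "h 1 2 * (l1 + l2 * s + s ^ 3) = h 2 4 - h 1 4 * s + h 1 2 * s ^ 3"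
      "h 1 2 * (m1 + m2 * s + s\<^sup>2) = h 2 3 - h 1 3 * s + h 1 2 * s\<^sup>2"
      using h12 by (simp_all add: lm field_simps)
    then show ?thesis
      unfolding P using no_common_root[OF assms(1,2), of s] by (auto simp: h_def)
  qed
  then obtain \<delta> where "\<delta> > 0"
    "\<And>s. \<delta> \<le> norm (poly [:l1, l2, 0, 1:] s) \<or> \<delta> \<le> norm (poly [:m1, m2, 1:] s)"
    using poly_pair_bounded_below[of "[:m1, m2, 1:]" "[:l1, l2, 0, 1:]"] by auto
  then show ?thesis
    using that[of l1 l2 m1 m2 \<delta>] 0[of a] 0[of b] unfolding P by blast
qed

text \<open>Off \<alpha> the resolvent coefficients lie, up to the factor s^2 with s = 1/(z -
  \<alpha>), on the curve (1, s, s^2, s^3). There one functional has modulus at least \<delta>, so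
  the entry (1,5) or (2,5) dominates the entry (6,7).\<close>

lemma identical_pseudospectra_nilp:
  assumes "\<delta> \<ge> 0" "r \<ge> 0"
    and \<delta>: "\<And>s. \<delta> \<le> norm (l1 + l2 * s + s ^ 3) \<or> \<delta> \<le> norm (m1 + m2 * s + s\<^sup>2)"
  defines "N \<equiv> nilp l1 l2 m1 m2 (of_real r)" and "t \<equiv> of_real (\<delta> * r ^ 3)"
  shows "identical_pseudospectra (mat \<alpha> + (N + elem 6 7 t)) (mat \<alpha> + N)"
proof -
  have N: "mpow N 5 = 0" "mpow (N + elem 6 7 t) 5 = 0"
    using mpow_nilp(4) mpow_nilp_add_elem[of l1 l2 m1 m2 "of_real r" t 3] by (simp_all add: N_def)
  have "opnorm (resolvent (mat \<alpha> + (N + elem 6 7 t)) z) = opnorm (resolvent (mat \<alpha> + N) z)"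
    if "z \<noteq> \<alpha>" for z
  proof -
    define s where "s = 1 / (z - \<alpha>)"
    define c where "c k = s ^ Suc k" for k
    have c: "(\<lambda>k. 1 / (z - \<alpha>) ^ Suc k) = c"
      by (simp add: c_def s_def power_divide fun_eq_iff)
    have L: "c 1 * l1 + c 2 * l2 + c 4 = s\<^sup>2 * (l1 + l2 * s + s ^ 3)"
      "c 1 * m1 + c 2 * m2 + c 3 = s\<^sup>2 * (m1 + m2 * s + s\<^sup>2)"
      unfolding c_def by (simp_all add: eval_nat_numeral algebra_simps)
    have t: "norm (c 1 * t) = norm s ^ 2 * (\<delta> * r ^ 3)"
      using assms(1,2) by (simp add: c_def t_def norm_mult norm_power power2_eq_square)
    have "norm (c 1 * t) \<le> norm (s\<^sup>2 * x * of_real r ^ 3)" if "\<delta> \<le> norm x" for x :: complex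
      using assms(1,2) that unfolding t
      by (simp add: norm_mult norm_power mult.assoc mult_left_mono mult_right_mono)
    then have "norm (c 1 * t) \<le> norm ((c 1 * l1 + c 2 * l2 + c 4) * of_real r ^ 3)
        \<or> norm (c 1 * t) \<le> norm ((c 1 * m1 + c 2 * m2 + c 3) * of_real r ^ 3)"
      unfolding L using \<delta>[of s] by blast
    then show ?thesis
      unfolding resolvent_nilpotent[OF N(1) that] resolvent_nilpotent[OF N(2) that] c
      unfolding N_def by (rule opnorm_mpoly_nilp_add_elem)
  qed
  then show ?thesis
    unfolding identical_pseudospectra_def resolvent_norm_def mat_spectrum_nilpotent[OF N(1)]
      mat_spectrum_nilpotent[OF N(2)]
    by simp
qed

text \<open>The entry (6,7) makes the numerator grow at least like \<open>r ^ 3\<close>, while the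
  denominator is of order at most \<open>r\<^sup>2\<close>. The eventual form lets a single r serve
  both f and g.\<close>

lemma opnorm_ratio_eventually_large:
  fixes M \<delta> :: real
  assumes c: "c 1 \<noteq> 0" "c 1 * l1 + c 2 * l2 + c 4 = 0" "c 1 * m1 + c 2 * m2 + c 3 = 0"
    and "M > 0" "\<delta> > 0"
  shows "\<forall>\<^sub>F r in at_top.
    M < opnorm (mpoly 5 c (nilp l1 l2 m1 m2 (of_real r) + elem 6 7 (of_real (\<delta> * r ^ 3))))
      / opnorm (mpoly 5 c (nilp l1 l2 m1 m2 (of_real r)))"
proof -
  obtain K where K: "\<forall>r\<ge>1. opnorm (mpoly 5 c (nilp l1 l2 m1 m2 (of_real r))) \<le> K * r\<^sup>2"
    using opnorm_mpoly_nilp_bound[OF c(2,3)] by blast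
  have large: "M < opnorm (mpoly 5 c (nilp l1 l2 m1 m2 (of_real r) + elem 6 7 (of_real (\<delta> * r ^ 3))))
      / opnorm (mpoly 5 c (nilp l1 l2 m1 m2 (of_real r)))"
    if r: "1 \<le> r" "M * K / (norm (c 1) * \<delta>) < r" for r
  proof -
    let ?B = "mpoly 5 c (nilp l1 l2 m1 m2 (of_real r))"
    let ?A = "mpoly 5 c (nilp l1 l2 m1 m2 (of_real r) + elem 6 7 (of_real (\<delta> * r ^ 3)))"
    \<comment> \<open>This entry keeps the denominator positive; a zero denominator would make the
      quotient 0.\<close>
    have "?B $ 1 $ 2 = c 1"
      by (simp add: mpoly_nilp mat_def upper_def elem_def)
    then have pos: "opnorm ?B > 0"
      using entry_le_opnorm[of ?B 1 2] c(1) by (simp add: less_le_trans[of 0 "norm (c 1)"])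
    have "?A $ 6 $ 7 = c 1 * of_real (\<delta> * r ^ 3)"
      unfolding mpoly_nilp_add_elem by (simp add: mpoly_nilp mat_def upper_def elem_def)
    then have A: "norm (c 1) * \<delta> * r ^ 3 \<le> opnorm ?A"
      using entry_le_opnorm[of ?A 6 7] r \<open>\<delta> > 0\<close> by (simp add: norm_mult norm_power)
    have "M * opnorm ?B \<le> (M * K) * r\<^sup>2"
      using K r(1) \<open>M > 0\<close> by (simp add: mult.assoc mult_left_mono)
    also have "\<dots> < (norm (c 1) * \<delta> * r) * r\<^sup>2"
      using r c(1) \<open>\<delta> > 0\<close> by (intro mult_strict_right_mono) (simp_all add: field_simps)
    also have "\<dots> \<le> opnorm ?A"
      using A by (simp add: eval_nat_numeral mult_ac)
    finally show ?thesis
      using pos by (simp add: field_simps)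
  qed
  have "\<forall>\<^sub>F r in at_top. 1 \<le> r \<and> M * K / (norm (c 1) * \<delta>) < r"
    by (intro eventually_conj eventually_ge_at_top eventually_gt_at_top)
  then show ?thesis
    by (rule eventually_mono) (use large in blast)
qed

theorem theorem1p2:
  fixes f g :: "complex \<Rightarrow> complex" and \<Omega> :: "complex set" and M :: real
  assumes "open \<Omega>" "connected \<Omega>" "\<Omega> \<noteq> {}"
    and "f holomorphic_on \<Omega>" "g holomorphic_on \<Omega>"
    and "M > 0"
    and "let h = htilde f g in \<exists>z\<in>\<Omega>.
        h 1 2 z * ((h 2 4 z)^2 - h 3 4 z * (2 * h 2 3 z + h 1 4 z))
      + h 1 3 z * (h 1 3 z * h 3 4 z - h 2 3 z * h 2 4 z)
      + (h 2 3 z)^3 \<noteq> 0"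
  shows "\<exists>A B :: complex^10^10.
      mat_spectrum A \<subseteq> \<Omega> \<and> mat_spectrum B \<subseteq> \<Omega> \<and>
      identical_pseudospectra A B \<and>
      opnorm (hol_fun_calc \<Omega> f A) / opnorm (hol_fun_calc \<Omega> f B) > M \<and>
      opnorm (hol_fun_calc \<Omega> g A) / opnorm (hol_fun_calc \<Omega> g B) > M"
proof -
  have "\<exists>z\<in>\<Omega>. chow f g z \<noteq> 0"
    using assms(7) by (simp add: chow_def Let_def)
  then obtain \<alpha> where \<alpha>: "\<alpha> \<in> \<Omega>" "chow f g \<alpha> \<noteq> 0" "htilde f g 1 2 \<alpha> \<noteq> 0" "deriv f \<alpha> \<noteq> 0"
      "deriv g \<alpha> \<noteq> 0"
    using obtains_base_point[OF assms(1,4,5)] by blast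
  define a b where ab: "a = (\<lambda>k. (deriv ^^ k) f \<alpha> / fact k)" "b = (\<lambda>k. (deriv ^^ k) g \<alpha> / fact k)"
  obtain l1 l2 m1 m2 \<delta> where lm: "a 1 * l1 + a 2 * l2 + a 4 = 0" "a 1 * m1 + a 2 * m2 + a 3 = 0"
      "b 1 * l1 + b 2 * l2 + b 4 = 0" "b 1 * m1 + b 2 * m2 + b 3 = 0"
    and \<delta>: "\<delta> > 0" "\<forall>s. \<delta> \<le> norm (l1 + l2 * s + s ^ 3) \<or> \<delta> \<le> norm (m1 + m2 * s + s\<^sup>2)"
    unfolding ab by (rule exists_annihilating_pair[OF \<alpha>(2,3)])
  have ab1: "a 1 \<noteq> 0" "b 1 \<noteq> 0"
    using \<alpha> by (simp_all add: ab)
  define N where "N r = nilp l1 l2 m1 m2 (of_real r)" for r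
  define N' where "N' r = N r + elem 6 7 (of_real (\<delta> * r ^ 3))" for r
  have "\<forall>\<^sub>F r in at_top. 0 \<le> r \<and> M < opnorm (mpoly 5 a (N' r)) / opnorm (mpoly 5 a (N r))
      \<and> M < opnorm (mpoly 5 b (N' r)) / opnorm (mpoly 5 b (N r))"
    unfolding N'_def N_def
    by (intro eventually_conj eventually_ge_at_top opnorm_ratio_eventually_large ab1 lm assms(6) \<delta>(1))
  then obtain r where r: "0 \<le> r" "M < opnorm (mpoly 5 a (N' r)) / opnorm (mpoly 5 a (N r))"
      "M < opnorm (mpoly 5 b (N' r)) / opnorm (mpoly 5 b (N r))"
    using eventually_happens'[OF trivial_limit_at_top_linorder] by blast
  \<comment> \<open>The instance k = 3 of \<open>mpow_nilp_add_elem\<close> concerns the fifth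
    power.\<close>
  have nil: "mpow (N r) 5 = 0" "mpow (N' r) 5 = 0"
    using mpow_nilp(4) mpow_nilp_add_elem[of l1 l2 m1 m2 "of_real r" "of_real (\<delta> * r ^ 3)" 3]
    by (simp_all add: N_def N'_def)
  note calc = hol_fun_calc_nilpotent[OF assms(1,2) \<alpha>(1)]
  show ?thesis
  proof (intro exI conjI)
    show "identical_pseudospectra (mat \<alpha> + N' r) (mat \<alpha> + N r)"
      unfolding N'_def N_def
      by (rule identical_pseudospectra_nilp) (use \<delta> r(1) in auto)
  qed (use \<alpha>(1) r(2,3) in \<open>simp_all only: calc[OF assms(4) nil(1)] calc[OF assms(4) nil(2)]
      calc[OF assms(5) nil(1)] calc[OF assms(5) nil(2)] mat_spectrum_nilpotent[OF nil(1)]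
      mat_spectrum_nilpotent[OF nil(2)] ab, simp_all\<close>)
qed

end
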